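(* Suppose $k, n, \ell \in \omega$ with $\ell \geq 1$, where \[ \left\lfloor \frac{n}{\ell} \right\rfloor \geq 2^{3k+3} \qquad\text{and}\qquad n \geq \frac{-2^{4k+7}}{\log_2\left(1-\frac{1}{(k+1)\cdot 2^{k+1}}\right)}. \] Then \[ \frac{\left|\{\mathcal{G} \in \mathbb{G}_{k+1}(n) : (\exists \mathcal{H} \in \mathbb{G}_{k}(n))\ \mathcal{G} \cong \mathcal{H}\}\right|}{\left|\mathbb{G}_{k+1}(n)\right|} \leq \left(\left(1-\frac{1}{(k+1)\cdot 2^{k+1}}\right)^{\frac{1}{2^{3k+3}}}\right)^{n} \cdot 2^{2^{3k+5}}. \]
   Context: Notation: $\omega=\{0,1,2,\dots\}$ and $[m]=\{0,1,\dots,m-1\}$; $\mathcal{P}(Z)$ is the power set of $Z$. Graphs are simple undirected graphs. For $k,n\in\omega$, a $k$-rainbow sequence on $[n]$ is a pair $S=(a,e)$ of functions $a:[n]\to[k]$ and $e:[n]\to\mathcal{P}([k])$. The graph associated with $S$ is the graph on vertex set $[n]$ in which, for all $x<y$ in $[n]$, $x$ and $y$ are adjacent if and only if $a(x)\in e(y)$. $\mathbb{G}_k(n)$ denotes the set of all (labelled) graphs on vertex set $[n]$ that are associated with some $k$-rainbow sequence on $[n]$ (the $k$-rainbow threshold graphs on $[n]$). $\cong$ denotes graph isomorphism. *)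

theory Defs
  imports Complex_Main "HOL-Library.FuncSet"
begin

text \<open>A graph is a pair of a vertex set and a set of edges, an edge being an unordered pair
  \<open>{x, y}\<close> of distinct vertices.\<close>

type_synonym 'a graph = "'a set \<times> 'a set set"

definition verts :: "'a graph \<Rightarrow> 'a set" where
  "verts G = fst G"

definition adjacent :: "'a graph \<Rightarrow> 'a \<Rightarrow> 'a \<Rightarrow> bool" where
  "adjacent G x y \<longleftrightarrow> {x, y} \<in> snd G"

definition simple_graph :: "'a graph \<Rightarrow> bool" where
  "simple_graph G \<longleftrightarrow> (\<forall>d\<in>snd G. d \<subseteq> verts G \<and> card d = 2)"

definition graph_iso :: "'a graph \<Rightarrow> 'b graph \<Rightarrow> bool" where
  "graph_iso G H \<longleftrightarrow>
     (\<exists>f. bij_betw f (verts G) (verts H) \<and>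
          (\<forall>x\<in>verts G. \<forall>y\<in>verts G. adjacent G x y \<longleftrightarrow> adjacent H (f x) (f y)))"

text \<open>Functions with domain \<open>[n] = {..<n}\<close> are encoded as extensional functions on \<^typ>\<open>nat\<close>.\<close>

definition rainbow_seqs :: "nat \<Rightarrow> nat \<Rightarrow> ((nat \<Rightarrow> nat) \<times> (nat \<Rightarrow> nat set)) set" where
  "rainbow_seqs k n = ({..<n} \<rightarrow>\<^sub>E {..<k}) \<times> ({..<n} \<rightarrow>\<^sub>E Pow {..<k})"

definition assoc_graph :: "nat \<Rightarrow> (nat \<Rightarrow> nat) \<times> (nat \<Rightarrow> nat set) \<Rightarrow> nat graph" where
  "assoc_graph n S = ({..<n}, {{x, y} | x y. x < y \<and> y < n \<and> fst S x \<in> snd S y})"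

definition rainbow_graphs :: "nat \<Rightarrow> nat \<Rightarrow> nat graph set" where
  "rainbow_graphs k n = assoc_graph n ` rainbow_seqs k n"

lemma verts_assoc_graph: "verts (assoc_graph n S) = {..<n}"
  by (simp add: verts_def assoc_graph_def)

lemma adjacent_assoc_graph:
  assumes "x < y" "y < n"
  shows "adjacent (assoc_graph n (a, e)) x y \<longleftrightarrow> a x \<in> e y"
  using assms by (auto simp: adjacent_def assoc_graph_def doubleton_eq_iff)

lemma simple_graph_assoc_graph: "simple_graph (assoc_graph n S)"
  by (auto simp: simple_graph_def assoc_graph_def verts_def card_2_iff)

lemma finite_rainbow_graphs: "finite (rainbow_graphs k n)"
  by (simp add: rainbow_graphs_def rainbow_seqs_def finite_PiE)

end

(* An induced matching with k + 1 edges never occurs in a k-rainbow threshold graph: by pigeonhole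
   the earlier endpoints of two matching edges share a colour, and then the later endpoint of one
   edge is adjacent to the earlier endpoint of the other.  Put K = k + 1.  A K-rainbow sequence
   containing the entries (0, {}), ..., (K - 1, {}), (0, {0}), ..., (0, {K - 1}) in this order does
   induce such a matching, and a sequence avoids this pattern only if one of 2 K disjoint blocks of
   length b misses a prescribed entry, which happens for a fraction of at most
   2 K (1 - 1 / (K 2^K))^b of all (K 2^K)^n sequences.  Conversely, a sequence whose first K entries
   carry all colours and whose last K entries pick out the single colours is determined by its
   graph, so that there are at least (K 2^K)^(n - 2 K) graphs. *)

theory Submission
  imports Defs
begin

section \<open>Induced matchings as an obstruction\<close>

lemma adjacent_commute: "adjacent G x y \<longleftrightarrow> adjacent G y x"
  by (simp add: adjacent_def insert_commute)

lemma not_adjacent_assoc_graph_refl: "\<not> adjacent (assoc_graph n S) x x"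
  by (auto simp: adjacent_def assoc_graph_def doubleton_eq_iff)

text \<open>The two maps list the endpoints of each edge in no particular order. Vertices of
  different edges are automatically distinct: a shared vertex would be adjacent to its partner in
  the other edge, against the second clause.\<close>

definition induced_matching :: "'a graph \<Rightarrow> nat \<Rightarrow> (nat \<Rightarrow> 'a) \<Rightarrow> (nat \<Rightarrow> 'a) \<Rightarrow> bool" where
  "induced_matching G m f g \<longleftrightarrow>
     (\<forall>i<m. f i \<in> verts G \<and> g i \<in> verts G \<and> adjacent G (f i) (g i)) \<and>
     (\<forall>i<m. \<forall>j<m. i \<noteq> j \<longrightarrow> (\<forall>x\<in>{f i, g i}. \<forall>y\<in>{f j, g j}. \<not> adjacent G x y))"

lemma induced_matching_graph_iso:
  assumes "graph_iso G H" and "induced_matching G m f g"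
  shows "\<exists>f' g'. induced_matching H m f' g'"
proof -
  obtain h where h: "bij_betw h (verts G) (verts H)"
    "\<forall>x\<in>verts G. \<forall>y\<in>verts G. adjacent G x y \<longleftrightarrow> adjacent H (h x) (h y)"
    using assms(1) by (auto simp: graph_iso_def)
  have "induced_matching H m (h \<circ> f) (h \<circ> g)"
    using assms(2) h bij_betwE[OF h(1)] unfolding induced_matching_def by auto
  then show ?thesis by blast
qed

lemma no_induced_matching_rainbow_graphs:
  assumes "H \<in> rainbow_graphs k n" and m: "induced_matching H m f g" and "k < m"
  shows False
proof -
  obtain a e where H: "H = assoc_graph n (a, e)" and a: "\<And>x. x < n \<Longrightarrow> a x < k"
    using assms(1) by (force simp: rainbow_graphs_def rainbow_seqs_def PiE_iff)
  define p where "p i = min (f i) (g i)" for i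
  define q where "q i = max (f i) (g i)" for i
  have fg: "f i < n" "g i < n" "adjacent H (f i) (g i)" if "i < m" for i
    using m that by (auto simp: induced_matching_def H verts_assoc_graph)
  have pq: "p i < q i" "q i < n" "a (p i) \<in> e (q i)" if "i < m" for i
  proof -
    have "f i \<noteq> g i"
      using fg(3)[OF that] by (auto simp: H not_adjacent_assoc_graph_refl)
    then show *: "p i < q i" by (auto simp: p_def q_def)
    show n: "q i < n" using fg that by (simp add: q_def)
    have "adjacent H (p i) (q i)"
      using fg(3)[OF that] by (auto simp: p_def q_def min_def max_def adjacent_commute)
    then show "a (p i) \<in> e (q i)"
      using adjacent_assoc_graph[OF * n] by (simp add: H)
  qed
  have "(a \<circ> p) ` {..<m} \<subseteq> {..<k}"
  proof (intro image_subsetI)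
    fix i assume "i \<in> {..<m}"
    then have "p i < n" using pq(1,2)[of i] by simp
    then show "(a \<circ> p) i \<in> {..<k}" using a by simp
  qed
  then have "card ((a \<circ> p) ` {..<m}) \<le> card {..<k}"
    by (intro card_mono) simp
  then have "card ((a \<circ> p) ` {..<m}) < card {..<m}"
    using \<open>k < m\<close> by simp
  then have "\<not> inj_on (a \<circ> p) {..<m}"
    by (rule pigeonhole)
  \<comment> \<open>By symmetry the two edges are ordered so that \<open>p i \<le> p j\<close>. Then
    \<open>p i < q j\<close>, so the adjacency of these vertices is decided by
    \<open>e (q j)\<close>, which contains the common colour.\<close>
  then obtain i j where ij: "i < m" "j < m" "i \<noteq> j" "a (p i) = a (p j)" "p i \<le> p j"
    unfolding inj_on_def by (metis comp_apply lessThan_iff linorder_le_cases)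
  have "adjacent H (p i) (q j)"
    using adjacent_assoc_graph[of "p i" "q j" n a e] ij pq[of j] by (simp add: H)
  moreover have "p i \<in> {f i, g i}" "q j \<in> {f j, g j}"
    by (auto simp: p_def q_def min_def max_def)
  ultimately show False
    using m ij unfolding induced_matching_def by blast
qed

section \<open>Rainbow sequences as words of entries\<close>

definition entries :: "nat \<Rightarrow> (nat \<times> nat set) set" where
  "entries k = {..<k} \<times> Pow {..<k}"

definition entry_graph :: "nat \<Rightarrow> (nat \<Rightarrow> nat \<times> nat set) \<Rightarrow> nat graph" where
  "entry_graph n s = assoc_graph n (fst \<circ> s, snd \<circ> s)"

lemma finite_entries: "finite (entries k)"
  by (simp add: entries_def)

lemma card_entries: "card (entries k) = k * 2 ^ k"
  by (simp add: entries_def card_cartesian_product card_Pow)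

lemma adjacent_entry_graph:
  "x < y \<Longrightarrow> y < n \<Longrightarrow> adjacent (entry_graph n s) x y \<longleftrightarrow> fst (s x) \<in> snd (s y)"
  by (simp add: entry_graph_def adjacent_assoc_graph)

lemma assoc_graph_cong:
  assumes "\<And>x. x < n \<Longrightarrow> fst S x = fst T x" and "\<And>x. x < n \<Longrightarrow> snd S x = snd T x"
  shows "assoc_graph n S = assoc_graph n T"
proof -
  have "x < y \<and> y < n \<and> fst S x \<in> snd S y \<longleftrightarrow> x < y \<and> y < n \<and> fst T x \<in> snd T y" for x y
    using assms by (metis less_trans)
  then show ?thesis by (simp add: assoc_graph_def)
qed

text \<open>Merging colour and set turns a sequence into a word over an alphabet of
  \<open>k * 2 ^ k\<close> letters, so that letters can be prescribed, forbidden and counted.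
  Restriction to \<open>{..<n}\<close> restores extensionality without changing the graph.\<close>

lemma rainbow_graphs_eq_image:
  "rainbow_graphs k n = entry_graph n ` ({..<n} \<rightarrow>\<^sub>E entries k)"
proof (intro equalityI subsetI)
  fix G assume "G \<in> rainbow_graphs k n"
  then obtain a e where ae: "a \<in> {..<n} \<rightarrow>\<^sub>E {..<k}" "e \<in> {..<n} \<rightarrow>\<^sub>E Pow {..<k}"
    and G: "G = assoc_graph n (a, e)"
    by (auto simp: rainbow_graphs_def rainbow_seqs_def)
  let ?s = "restrict (\<lambda>x. (a x, e x)) {..<n}"
  have "G = entry_graph n ?s"
    unfolding G entry_graph_def by (rule assoc_graph_cong) auto
  moreover have "?s \<in> {..<n} \<rightarrow>\<^sub>E entries k"
    using ae by (auto simp: entries_def PiE_iff)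
  ultimately show "G \<in> entry_graph n ` ({..<n} \<rightarrow>\<^sub>E entries k)" by blast
next
  fix G assume "G \<in> entry_graph n ` ({..<n} \<rightarrow>\<^sub>E entries k)"
  then obtain s where s: "s \<in> {..<n} \<rightarrow>\<^sub>E entries k" and G: "G = entry_graph n s"
    by auto
  let ?S = "(restrict (fst \<circ> s) {..<n}, restrict (snd \<circ> s) {..<n})"
  have "G = assoc_graph n ?S"
    unfolding G entry_graph_def by (rule assoc_graph_cong) auto
  moreover have "?S \<in> rainbow_seqs k n"
    using s by (fastforce simp: rainbow_seqs_def entries_def PiE_iff mem_Times_iff)
  ultimately show "G \<in> rainbow_graphs k n" by (auto simp: rainbow_graphs_def)
qed

section \<open>The pattern that forces an induced matching\<close>

definition matching_entry :: "nat \<Rightarrow> nat \<Rightarrow> nat \<times> nat set" where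
  "matching_entry m j = (if j < m then (j, {}) else (0, {j - m}))"

lemma matching_entry_in_entries: "j < 2 * m \<Longrightarrow> matching_entry m j \<in> entries m"
  by (auto simp: matching_entry_def entries_def)

text \<open>Empty sets keep the first half independent, and the set \<open>{j}\<close> at
  \<open>z (m + j)\<close> selects only \<open>z j\<close> there. In the second half all colours are
  0; only the set at \<open>z m\<close> contains 0, and no other vertex of that half precedes
  \<open>z m\<close>.\<close>

lemma induced_matching_entry_graph:
  assumes mono: "\<And>i j. i < j \<Longrightarrow> j < 2 * m \<Longrightarrow> z i < z j"
    and n: "\<And>j. j < 2 * m \<Longrightarrow> z j < n"
    and s: "\<And>j. j < 2 * m \<Longrightarrow> s (z j) = matching_entry m j"
  shows "induced_matching (entry_graph n s) m z (\<lambda>i. z (m + i))"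
proof -
  let ?G = "entry_graph n s"
  have adj: "adjacent ?G (z i) (z j) \<longleftrightarrow> m \<le> j \<and> fst (matching_entry m i) = j - m"
    if "i < j" "j < 2 * m" for i j
    using adjacent_entry_graph[OF mono n, of i j s] s[of i] s[of j] that
    by (auto simp: matching_entry_def)
  have less: "\<not> adjacent ?G x y"
    if "i < j" "j < m" "x \<in> {z i, z (m + i)}" "y \<in> {z j, z (m + j)}" for i j x y
    using that adj[of i j] adj[of i "m + j"] adj[of j "m + i"] adj[of "m + i" "m + j"]
    by (auto simp: matching_entry_def adjacent_commute)
  have "\<not> adjacent ?G x y"
    if "i \<noteq> j" "i < m" "j < m" "x \<in> {z i, z (m + i)}" "y \<in> {z j, z (m + j)}" for i j x y
    using less[of i j x y] less[of j i y x] that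
    by (metis adjacent_commute linorder_neqE_nat)
  moreover have "adjacent ?G (z i) (z (m + i))" if "i < m" for i
    using adj[of i "m + i"] that by (simp add: matching_entry_def)
  ultimately show ?thesis
    using n unfolding induced_matching_def by (auto simp: entry_graph_def verts_assoc_graph)
qed

section \<open>Counting words and graphs\<close>

lemma card_PiE_avoiding:
  assumes "finite I" "B \<subseteq> I" "finite T" "t \<in> T"
  shows "card {s \<in> I \<rightarrow>\<^sub>E T. \<forall>x\<in>B. s x \<noteq> t} = (card T - 1) ^ card B * card T ^ (card I - card B)"
proof -
  have "{s \<in> I \<rightarrow>\<^sub>E T. \<forall>x\<in>B. s x \<noteq> t} = (\<Pi>\<^sub>E x\<in>I. if x \<in> B then T - {t} else T)"
    using assms(2) by (fastforce simp: PiE_iff split: if_splits)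
  also have "card \<dots> = (\<Prod>x\<in>I. if x \<in> B then card T - 1 else card T)"
    using assms by (auto simp: card_PiE intro!: prod.cong)
  also have "\<dots> = (card T - 1) ^ card B * card T ^ (card I - card B)"
    using assms(1,2) by (simp add: prod.If_cases Int_absorb1 card_Diff_subset finite_subset
        flip: Diff_eq)
  finally show ?thesis .
qed

text \<open>Adjacency to the first \<open>m\<close> vertices reads off the set of a middle entry,
  and adjacency to the last \<open>m\<close> vertices its colour. The \<open>n - 2 * m\<close>
  middle entries are arbitrary.\<close>

lemma card_rainbow_graphs_lower:
  assumes "2 * m \<le> n" and "0 < m"
  shows "(m * 2 ^ m) ^ (n - 2 * m) \<le> card (rainbow_graphs m n)"
proof -
  define F where "F x = (if x < m then {(x, {})} else if n - m \<le> x then {(0, {x - (n - m)})}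
    else entries m)" for x
  have F_sub: "F x \<subseteq> entries m" if "x < n" for x
    using assms that by (auto simp: F_def entries_def)
  have "card (Pi\<^sub>E {..<n} F) = (\<Prod>x<n. if x \<in> {m..<n - m} then m * 2 ^ m else 1)"
    by (auto simp: card_PiE F_def card_entries intro!: prod.cong)
  also have "\<dots> = (m * 2 ^ m) ^ card ({..<n} \<inter> {m..<n - m})"
    by (simp add: prod.If_cases Int_def)
  also have "{..<n} \<inter> {m..<n - m} = {m..<n - m}" by auto
  finally have card: "card (Pi\<^sub>E {..<n} F) = (m * 2 ^ m) ^ (n - 2 * m)"
    by (simp flip: mult_2)
  have "inj_on (entry_graph n) (Pi\<^sub>E {..<n} F)"
  proof (rule inj_onI)
    fix s t assume st: "s \<in> Pi\<^sub>E {..<n} F" "t \<in> Pi\<^sub>E {..<n} F"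
      and eq: "entry_graph n s = entry_graph n t"
    have val: "r x = (x, {})" if "x < m" "r \<in> Pi\<^sub>E {..<n} F" for x r
    proof -
      have "r x \<in> F x" using that assms by (intro PiE_mem[OF that(2)]) simp
      then show ?thesis using that by (simp add: F_def)
    qed
    have val': "r (n - m + i) = (0, {i})" if "i < m" "r \<in> Pi\<^sub>E {..<n} F" for i r
    proof -
      have "r (n - m + i) \<in> F (n - m + i)" using that assms by (intro PiE_mem[OF that(2)]) simp
      moreover have "F (n - m + i) = {(0, {i})}"
        using that(1) assms by (simp add: F_def del: Nat.add_diff_assoc2)
      ultimately show ?thesis by blast
    qed
    have adj: "fst (s x) \<in> snd (s y) \<longleftrightarrow> fst (t x) \<in> snd (t y)" if "x < y" "y < n" for x y
      using adjacent_entry_graph[OF that] eq by metis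
    have "s x = t x" if x: "x < n" for x
    proof (cases "m \<le> x \<and> x < n - m")
      case True
      have "s x \<in> entries m" "t x \<in> entries m"
        using st F_sub x by (meson PiE_mem lessThan_iff subsetD)+
      then have sub: "fst (s x) < m" "snd (s x) \<subseteq> {..<m}" "snd (t x) \<subseteq> {..<m}"
        by (auto simp: entries_def)
      have "i \<in> snd (s x) \<longleftrightarrow> i \<in> snd (t x)" if "i < m" for i
        using adj[of i x] val[OF that st(1)] val[OF that st(2)] True x that by simp
      then have snd: "snd (s x) = snd (t x)" using sub by blast
      \<comment> \<open>This later vertex carries the singleton of the colour that \<open>s\<close>
        gives to \<open>x\<close>, so it is adjacent to \<open>x\<close> in the common graph; under
        \<open>t\<close> this forces the same colour.\<close>
      have "n - m + fst (s x) < n" using sub(1) assms(1) by linarith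
      then have "fst (s x) = fst (t x)"
        using adj[of x "n - m + fst (s x)"] val'[OF sub(1) st(1)] val'[OF sub(1) st(2)] sub(1) True
        by (simp del: Nat.add_diff_assoc2)
      with snd show ?thesis by (simp add: prod_eq_iff)
    next
      case False
      then have "x < m \<or> (x - (n - m) < m \<and> x = n - m + (x - (n - m)))"
        using x assms(1) by linarith
      then consider "x < m" | i where "i < m" "x = n - m + i" by blast
      then show ?thesis
        by cases (simp_all only: val[OF _ st(1)] val[OF _ st(2)] val'[OF _ st(1)] val'[OF _ st(2)])
    qed
    then show "s = t" using st by (intro PiE_ext[of s "{..<n}" F t]) auto
  qed
  then have "card (entry_graph n ` Pi\<^sub>E {..<n} F) = (m * 2 ^ m) ^ (n - 2 * m)"
    by (simp add: card card_image)
  moreover have "entry_graph n ` Pi\<^sub>E {..<n} F \<subseteq> rainbow_graphs m n"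
    unfolding rainbow_graphs_eq_image using F_sub by (intro image_mono PiE_mono) auto
  ultimately show ?thesis
    using card_mono[OF finite_rainbow_graphs] by metis
qed

text \<open>Each such graph comes from a word in which some block misses its prescribed letter. A
  union bound over the \<open>2 * m\<close> blocks counts these words.\<close>

lemma card_rainbow_graphs_iso_upper:
  fixes k n b :: nat
  defines "m \<equiv> Suc k"
  assumes b: "2 * m * b \<le> n"
  shows "card {G \<in> rainbow_graphs m n. \<exists>H \<in> rainbow_graphs k n. graph_iso G H}
    \<le> 2 * m * ((m * 2 ^ m - 1) ^ b * (m * 2 ^ m) ^ (n - b))" (is "card ?A \<le> _")
proof -
  \<comment> \<open>The blocks are consecutive intervals, so positions chosen one from each are
    automatically increasing. For \<open>b = 0\<close> they are empty and every word is bad, in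
    agreement with the bound.\<close>
  define B where "B j = {j * b..<Suc j * b}" for j
  define bad where "bad j = {s \<in> {..<n} \<rightarrow>\<^sub>E entries m. \<forall>x\<in>B j. s x \<noteq> matching_entry m j}" for j
  have B_sub: "B j \<subseteq> {..<n}" if "j < 2 * m" for j
  proof -
    have "Suc j * b \<le> 2 * m * b" using that by (intro mult_right_mono) auto
    then show ?thesis using b by (auto simp: B_def)
  qed
  have "?A \<subseteq> entry_graph n ` (\<Union>j<2 * m. bad j)"
  proof
    fix G assume "G \<in> ?A"
    then obtain s H where s: "s \<in> {..<n} \<rightarrow>\<^sub>E entries m" and G: "G = entry_graph n s"
      and H: "H \<in> rainbow_graphs k n" "graph_iso G H"
      by (auto simp: rainbow_graphs_eq_image[of m])
    have "\<exists>j<2 * m. s \<in> bad j"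
    \<comment> \<open>If every block contains its letter, the chosen positions give a matching with
      \<open>k + 1\<close> edges, which the isomorphism would carry into \<open>H\<close>.\<close>
    proof (rule ccontr)
      assume "\<not> (\<exists>j<2 * m. s \<in> bad j)"
      then have "\<forall>j. \<exists>x. j < 2 * m \<longrightarrow> x \<in> B j \<and> s x = matching_entry m j"
        using s by (auto simp: bad_def)
      then obtain z where z: "\<And>j. j < 2 * m \<Longrightarrow> z j \<in> B j"
        "\<And>j. j < 2 * m \<Longrightarrow> s (z j) = matching_entry m j"
        by metis
      have "z i < z j" if "i < j" "j < 2 * m" for i j
      proof -
        have "z i < Suc i * b" using z(1)[of i] that by (simp add: B_def)
        also have "\<dots> \<le> j * b" using that by (intro mult_right_mono) auto
        also have "\<dots> \<le> z j" using z(1)[of j] that by (simp add: B_def)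
        finally show ?thesis .
      qed
      then have "induced_matching G m z (\<lambda>i. z (m + i))"
        unfolding G using z B_sub by (intro induced_matching_entry_graph) blast+
      then show False
        using induced_matching_graph_iso[OF H(2)] no_induced_matching_rainbow_graphs[OF H(1)]
        by (metis lessI m_def)
    qed
    then show "G \<in> entry_graph n ` (\<Union>j<2 * m. bad j)" using G by blast
  qed
  moreover have fin: "finite (bad j)" for j
    by (simp add: bad_def finite_PiE finite_entries)
  ultimately have "card ?A \<le> card (entry_graph n ` (\<Union>j<2 * m. bad j))"
    by (intro card_mono) auto
  also have "\<dots> \<le> card (\<Union>j<2 * m. bad j)"
    using fin by (intro card_image_le) auto
  also have "\<dots> \<le> (\<Sum>j<2 * m. card (bad j))"
    by (intro card_UN_le) auto
  also have "\<dots> = (\<Sum>j<2 * m. (m * 2 ^ m - 1) ^ b * (m * 2 ^ m) ^ (n - b))"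
  proof (intro sum.cong refl)
    fix j assume "j \<in> {..<2 * m}"
    then have "card (bad j) = (card (entries m) - 1) ^ card (B j) *
      card (entries m) ^ (card {..<n} - card (B j))"
      unfolding bad_def
      by (intro card_PiE_avoiding B_sub finite_entries matching_entry_in_entries) auto
    then show "card (bad j) = (m * 2 ^ m - 1) ^ b * (m * 2 ^ m) ^ (n - b)"
      by (simp add: card_entries B_def)
  qed
  finally show ?thesis by simp
qed

section \<open>Numerical estimates and the final bound\<close>

lemma two_mult_Suc_le_power: "2 * Suc k \<le> 2 ^ (3 * k + 3)"
proof -
  have "Suc k \<le> 2 ^ k" using Suc_leI[OF less_exp] .
  then have "2 * Suc k \<le> 2 ^ (k + 1)" by simp
  also have "\<dots> \<le> 2 ^ (3 * k + 3)" by (intro power_increasing) auto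
  finally show ?thesis .
qed

text \<open>With \<open>m = Suc k\<close>, one factor 2 pays for rounding the block length,
  \<open>2 * m\<close> counts the blocks, and the last power compares all words with the
  \<open>2 * m\<close> fewer free positions of the lower bound.\<close>

lemma constant_bound:
  "2 * (2 * Suc k) * (Suc k * 2 ^ Suc k) ^ (2 * Suc k) \<le> (2::nat) ^ (2 ^ (3 * k + 5))"
proof -
  have k: "Suc k \<le> 2 ^ k" using Suc_leI[OF less_exp] .
  have "2 * (2 * Suc k) * (Suc k * 2 ^ Suc k) ^ (2 * Suc k)
      \<le> 2 * (2 * 2 ^ k) * (2 ^ k * 2 ^ Suc k) ^ (2 * Suc k)"
    using k by (intro mult_mono power_mono) auto
  also have "\<dots> = 2 ^ (k + 2 + (2 * k + 1) * (2 * Suc k))"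
  proof -
    have "2 * (2 * 2 ^ k) = (2::nat) ^ (k + 2)"
      by (simp add: power_add)
    moreover have "2 ^ k * 2 ^ Suc k = (2::nat) ^ (2 * k + 1)"
      by (simp flip: power_add mult_2)
    ultimately show ?thesis by (simp only: power_add power_mult)
  qed
  also have "\<dots> \<le> 2 ^ (2 ^ (3 * k + 5))"
  proof (intro power_increasing)
    have "k + 2 + (2 * k + 1) * (2 * Suc k) \<le> 32 * (Suc k * Suc k)" by simp
    also have "\<dots> \<le> 32 * (2 ^ k * 2 ^ k)" using k by (intro mult_left_mono mult_mono) auto
    also have "\<dots> = 2 ^ (2 * k + 5)"
      by (simp add: power_add power_even_eq power2_eq_square)
    also have "\<dots> \<le> 2 ^ (3 * k + 5)" by (intro power_increasing) auto
    finally show "k + 2 + (2 * k + 1) * (2 * Suc k) \<le> 2 ^ (3 * k + 5)" .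
  qed simp
  finally show ?thesis .
qed

text \<open>Rounding lowers the exponent \<open>n / N\<close> by less than 1, which costs a factor
  of at most \<open>1 / c\<close>, hence at most 2.\<close>

lemma power_div_le_powr:
  fixes c :: real
  assumes "1 / 2 \<le> c" "c \<le> 1" "0 < N"
  shows "c ^ (n div N) \<le> 2 * (c powr (1 / real N)) ^ n"
proof -
  have "real n / real N - 1 \<le> real (n div N)"
    using floor_correct[of "real n / real N"] by (simp add: floor_divide_of_nat_eq)
  then have "c powr real (n div N) \<le> c powr (real n / real N - 1)"
    using assms by (intro powr_mono') auto
  also have "\<dots> = c powr (real n / real N) / c"
    using assms by (simp add: powr_diff)
  also have "\<dots> \<le> c powr (real n / real N) / (1 / 2)"
    using assms by (intro divide_left_mono) auto
  finally show ?thesis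
    using assms by (simp add: powr_realpow powr_power)
qed

theorem theorem3p12:
  fixes k n l :: nat
  assumes "l \<ge> 1"
    and "\<lfloor>real n / real l\<rfloor> \<ge> 2 ^ (3 * k + 3)"
    and "real n \<ge> - (2 ^ (4 * k + 7)) / log 2 (1 - 1 / ((real k + 1) * 2 ^ (k + 1)))"
  shows "real (card {G \<in> rainbow_graphs (k + 1) n. \<exists>H \<in> rainbow_graphs k n. graph_iso G H})
           / real (card (rainbow_graphs (k + 1) n))
         \<le> ((1 - 1 / ((real k + 1) * 2 ^ (k + 1))) powr (1 / 2 ^ (3 * k + 3))) ^ n
             * 2 ^ (2 ^ (3 * k + 5))"
proof -
  define m where "m = Suc k"
  define N :: nat where "N = 2 ^ (3 * k + 3)"
  define D where "D = m * 2 ^ m"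
  define c where "c = 1 - 1 / real D"
  define b where "b = n div N"
  let ?A = "{G \<in> rainbow_graphs m n. \<exists>H \<in> rainbow_graphs k n. graph_iso G H}"
  have D: "real D = (real k + 1) * 2 ^ (k + 1)"
    by (simp add: D_def m_def algebra_simps)
  have D2: "2 \<le> D"
    using mult_le_mono[of 1 m "2 ^ 1" "2 ^ m"] power_increasing[of 1 m "2::nat"]
    by (simp add: D_def m_def)
  have mN: "2 * m \<le> N"
    using two_mult_Suc_le_power[of k] by (simp add: m_def N_def)
  have "real_of_int (2 ^ (3 * k + 3)) \<le> real n / real l"
    using assms(2) by (simp add: le_floor_iff)
  also have "\<dots> \<le> real n"
    using assms(1) by (simp add: divide_le_eq mult_le_cancel_left1)
  finally have "real N \<le> real n" by (simp add: N_def)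
  then have n: "2 * m \<le> n" using mN by simp
  \<comment> \<open>\<open>c\<close> is the proportion of entries that differ from a prescribed one;
    \<open>D \<ge> 2\<close> provides the lower bound 1/2 that the rounding estimate needs.\<close>
  have c: "1 / 2 \<le> c" "c \<le> 1" "c * real D = real (D - 1)"
    using D2 by (auto simp: c_def field_simps of_nat_diff)
  have "2 * m * b \<le> N * b" using mN by simp
  also have "\<dots> \<le> n" by (simp add: b_def)
  finally have mb: "2 * m * b \<le> n" .
  then have bn: "b \<le> n" by (simp add: m_def)
  have "real (card ?A) \<le> real (2 * m * ((D - 1) ^ b * D ^ (n - b)))"
    using card_rainbow_graphs_iso_upper[of k b n] mb unfolding m_def D_def of_nat_le_iff by simp
  also have "\<dots> = 2 * real m * c ^ b * (real D ^ b * real D ^ (n - b))"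
    by (simp only: of_nat_mult of_nat_power flip: c(3)) (simp add: power_mult_distrib)
  \<comment> \<open>Both sides are \<open>D ^ n\<close>; the regrouping isolates the lower bound for
    the number of all graphs.\<close>
  also have "real D ^ b * real D ^ (n - b) = real D ^ (2 * m) * real D ^ (n - 2 * m)"
    using bn n by (simp flip: power_add)
  finally have "real (card ?A) \<le> 2 * real m * c ^ b * real D ^ (2 * m) * real D ^ (n - 2 * m)"
    by (simp add: mult.assoc)
  also have "\<dots> \<le> 2 * real m * c ^ b * real D ^ (2 * m) * real (card (rainbow_graphs m n))"
  proof (rule mult_left_mono)
    have "real (D ^ (n - 2 * m)) \<le> real (card (rainbow_graphs m n))"
      using card_rainbow_graphs_lower[OF n] by (simp only: D_def of_nat_le_iff) (simp add: m_def)
    then show "real D ^ (n - 2 * m) \<le> real (card (rainbow_graphs m n))" by simp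
  qed (use c in simp)
  \<comment> \<open>The case of a zero denominator is settled by the convention that division by 0
    gives 0.\<close>
  finally have "real (card ?A) / real (card (rainbow_graphs m n))
      \<le> 2 * real m * c ^ b * real D ^ (2 * m)"
    using c by (cases "card (rainbow_graphs m n) = 0") (auto simp: divide_le_eq)
  also have "\<dots> \<le> 2 * real m * (2 * (c powr (1 / real N)) ^ n) * real D ^ (2 * m)"
    unfolding b_def using c
    by (intro mult_right_mono mult_left_mono power_div_le_powr) (auto simp: N_def)
  also have "\<dots> = (c powr (1 / real N)) ^ n * real (2 * (2 * m) * D ^ (2 * m))"
    by simp
  also have "\<dots> \<le> (c powr (1 / real N)) ^ n * real (2 ^ (2 ^ (3 * k + 5)))"
    using constant_bound[of k]
    by (intro mult_left_mono) (simp_all only: m_def D_def of_nat_le_iff zero_le_power powr_ge_zero)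
  finally show ?thesis
    by (simp only: c_def D N_def m_def Suc_eq_plus1 of_nat_power of_nat_numeral)
qed

end
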